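(* Let $A_1\in\mathbb{R}^{m_1\times n}$, $A_2\in\mathbb{R}^{m_2\times n}$ and let $d\le n$ be a positive integer. Let $P^*\in\mathcal{P}_d$ be an optimal solution of \[ \min_{P\in\mathcal{P}_d}\ \max_{i\in\{1,2\}}\Big(\max_{Q\in\mathcal{P}_d}\|A_iQ\|_F^2-\|A_iP\|_F^2\Big). \] Then $\max_{Q\in\mathcal{P}_d}\|A_1Q\|_F^2-\|A_1P^*\|_F^2=\max_{Q\in\mathcal{P}_d}\|A_2Q\|_F^2-\|A_2P^*\|_F^2$.
   Context: $\mathcal{P}_d=\{P\in\mathbb{R}^{n\times d}:P^TP=I_d\}$. *)

theory Defs
  imports "HOL-Analysis.Analysis"
begin

definition orthonormal_frames :: "(real ^ 'd ^ 'n) set"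
  where "orthonormal_frames = {P. transpose P ** P = mat 1}"

text \<open>The norm of a matrix, as an element of a Cartesian power of a Cartesian
  power of the reals, is its Frobenius norm.\<close>

lemma norm_matrix_frobenius:
  fixes A :: "real ^ 'n ^ 'm"
  shows "norm A = sqrt (\<Sum>i\<in>UNIV. \<Sum>j\<in>UNIV. (A $ i $ j)\<^sup>2)"
  by (simp add: norm_vec_def L2_set_def sum_nonneg)

definition pca_loss :: "real ^ 'n ^ 'm \<Rightarrow> real ^ 'd ^ 'n \<Rightarrow> real"
  where "pca_loss A P =
    (SUP Q \<in> (orthonormal_frames :: (real ^ 'd ^ 'n) set). (norm (A ** Q))\<^sup>2) - (norm (A ** P))\<^sup>2"

lemma norm_sq_orthonormal_frame:
  fixes P :: "real ^ 'd ^ 'n"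
  assumes "P \<in> orthonormal_frames"
  shows "(norm P)\<^sup>2 = real CARD('d)"
proof -
  have diag: "(\<Sum>i\<in>UNIV. (P $ i $ j)\<^sup>2) = 1" for j
  proof -
    have "(transpose P ** P) $ j $ j = 1"
      using assms by (simp add: orthonormal_frames_def mat_def)
    then show ?thesis
      by (simp add: matrix_matrix_mult_def transpose_def power2_eq_square)
  qed
  have "(norm P)\<^sup>2 = (\<Sum>i\<in>UNIV. \<Sum>j\<in>UNIV. (P $ i $ j)\<^sup>2)"
    by (simp add: norm_matrix_frobenius sum_nonneg)
  also have "\<dots> = (\<Sum>j\<in>UNIV. \<Sum>i\<in>UNIV. (P $ i $ j)\<^sup>2)"
    by (rule sum.swap)
  finally show ?thesis by (simp add: diag)
qed

lemma compact_orthonormal_frames: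
  "compact (orthonormal_frames :: (real ^ 'd ^ 'n) set)"
proof -
  have "norm P \<le> sqrt (real CARD('d))" if "P \<in> orthonormal_frames" for P :: "real ^ 'd ^ 'n"
    using norm_sq_orthonormal_frame[OF that] by (metis norm_ge_zero order_refl real_sqrt_unique)
  then have "bounded (orthonormal_frames :: (real ^ 'd ^ 'n) set)"
    by (auto simp: bounded_iff)
  moreover have "closed (orthonormal_frames :: (real ^ 'd ^ 'n) set)"
    unfolding orthonormal_frames_def matrix_matrix_mult_def transpose_def
    by (intro closed_Collect_eq continuous_intros)
  ultimately show ?thesis by (simp add: compact_eq_bounded_closed)
qed

text \<open>Hence the supremum in the definition of the loss is a maximum.\<close>

lemma pca_loss_attained:
  fixes A :: "real ^ 'n ^ 'm"
  assumes "(orthonormal_frames :: (real ^ 'd ^ 'n) set) \<noteq> {}"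
  obtains Q :: "real ^ 'd ^ 'n" where "Q \<in> orthonormal_frames"
    and "\<And>R :: real ^ 'd ^ 'n. R \<in> orthonormal_frames \<Longrightarrow> (norm (A ** R))\<^sup>2 \<le> (norm (A ** Q))\<^sup>2"
    and "\<And>P :: real ^ 'd ^ 'n. pca_loss A P = (norm (A ** Q))\<^sup>2 - (norm (A ** P))\<^sup>2"
proof -
  have "continuous_on orthonormal_frames (\<lambda>Q :: real ^ 'd ^ 'n. (norm (A ** Q))\<^sup>2)"
    unfolding matrix_matrix_mult_def by (intro continuous_intros)
  then obtain Q :: "real ^ 'd ^ 'n" where Q: "Q \<in> orthonormal_frames"
    "\<And>R :: real ^ 'd ^ 'n. R \<in> orthonormal_frames \<Longrightarrow> (norm (A ** R))\<^sup>2 \<le> (norm (A ** Q))\<^sup>2"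
    using continuous_attains_sup[OF compact_orthonormal_frames assms] by blast
  have "(SUP Q \<in> (orthonormal_frames :: (real ^ 'd ^ 'n) set). (norm (A ** Q))\<^sup>2) = (norm (A ** Q))\<^sup>2"
    using Q by (intro cSup_eq_maximum) auto
  then show ?thesis using that[OF Q] by (simp add: pca_loss_def)
qed

end

theory Submission
  imports Defs
begin

text \<open>The squared Frobenius norm of \<open>A P\<close>, as a function of the orthonormal frame \<open>P\<close>, has no
  spurious local maxima. Indeed, rotating a unit vector \<open>p\<close> of the column space \<open>U\<close> of a local
  maximiser towards \<open>u\<close> orthogonal to \<open>U\<close> shows that \<open>A p\<close> and \<open>A u\<close> are orthogonal and that
  \<open>norm (A u) \<le> norm u * norm (A p)\<close>; so the quadratic form \<open>x \<mapsto> (norm (A x))\<^sup>2\<close> splits along \<open>U\<close>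
  and its orthogonal complement, with the eigenvalues on \<open>U\<close> dominating those on the complement,
  and \<open>P\<close> is a global maximiser. Now if the first loss exceeded the second at a minimax solution,
  then, the second loss being continuous, the solution would be a local minimiser of the first loss,
  hence a global one; the first loss would vanish there, while the second is nonnegative.\<close>

text \<open>Keeps adjoint products in the form \<open>transpose A *v x\<close>, which the rules
  below match, instead of turning them into \<open>x v* A\<close>.\<close>

declare transpose_matrix_vector [simp del]

section \<open>The Frobenius inner product\<close>

lemma inner_matrix_vector_transpose:
  fixes A :: "real ^ 'n ^ 'm"
  shows "(A *v x) \<bullet> y = x \<bullet> (transpose A *v y)"
  by (metis dot_lmul_matrix inner_commute transpose_matrix_vector transpose_transpose)

lemma inner_matrix_eq_sum_columns:
  fixes X Y :: "real ^ 'n ^ 'm"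
  shows "X \<bullet> Y = (\<Sum>j\<in>UNIV. column j X \<bullet> column j Y)"
  unfolding inner_vec_def column_def by (simp add: sum.swap[of _ "UNIV :: 'm set"])

lemma norm_sq_matrix_eq_sum_columns:
  fixes X :: "real ^ 'n ^ 'm"
  shows "(norm X)\<^sup>2 = (\<Sum>j\<in>UNIV. (norm (column j X))\<^sup>2)"
  by (simp add: power2_norm_eq_inner inner_matrix_eq_sum_columns)

lemma column_matrix_mult:
  fixes A :: "real ^ 'n ^ 'm" and B :: "real ^ 'k ^ 'n"
  shows "column j (A ** B) = A *v column j B"
  by (simp add: vec_eq_iff column_def matrix_matrix_mult_def matrix_vector_mult_def)

lemma matrix_mult_diff_distrib:
  fixes A :: "real ^ 'n ^ 'm" and B C :: "real ^ 'k ^ 'n"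
  shows "A ** (B - C) = A ** B - A ** C"
  by (simp add: vec_eq_iff matrix_matrix_mult_def sum_subtractf right_diff_distrib)

lemma inner_matrix_mult_left:
  fixes X :: "real ^ 'n ^ 'm" and Y :: "real ^ 'k ^ 'n"
  shows "(X ** Y) \<bullet> Z = Y \<bullet> (transpose X ** Z)"
  by (simp add: inner_matrix_eq_sum_columns column_matrix_mult inner_matrix_vector_transpose)

lemma inner_transpose:
  fixes X Y :: "real ^ 'n ^ 'm"
  shows "transpose X \<bullet> transpose Y = X \<bullet> Y"
  unfolding inner_vec_def transpose_def by (simp add: sum.swap[of _ "UNIV :: 'm set"])

lemma inner_matrix_mult_right:
  fixes X :: "real ^ 'n ^ 'm" and Y :: "real ^ 'k ^ 'n"
  shows "(X ** Y) \<bullet> Z = X \<bullet> (Z ** transpose Y)"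
proof -
  have "(X ** Y) \<bullet> Z = (transpose Y ** transpose X) \<bullet> transpose Z"
    by (simp add: inner_transpose flip: matrix_transpose_mul)
  also have "\<dots> = transpose X \<bullet> transpose (Z ** transpose Y)"
    by (simp add: inner_matrix_mult_left matrix_transpose_mul transpose_transpose)
  finally show ?thesis by (simp add: inner_transpose)
qed

text \<open>The rank-one matrix w v^T. For a unit vector \<open>v\<close>, adding it to a matrix
  moves the image of \<open>v\<close> by \<open>w\<close> and fixes the images of vectors orthogonal
  to \<open>v\<close>.\<close>

definition outer_product :: "real ^ 'm \<Rightarrow> real ^ 'n \<Rightarrow> real ^ 'n ^ 'm"
  where "outer_product w v = (\<chi> i j. w $ i * v $ j)"

lemma outer_product_vector:
  "outer_product w v *v x = (v \<bullet> x) *\<^sub>R w"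
  by (simp add: outer_product_def vec_eq_iff matrix_vector_mult_def inner_vec_def
      sum_distrib_left mult_ac)

lemma matrix_mult_outer_product:
  "A ** outer_product w v = outer_product (A *v w) v"
  by (simp add: outer_product_def vec_eq_iff matrix_vector_mult_def matrix_matrix_mult_def
      sum_distrib_left mult_ac)

lemma inner_outer_product:
  "X \<bullet> outer_product w v = (X *v v) \<bullet> w"
  by (simp add: outer_product_def matrix_vector_mult_def inner_vec_def sum_distrib_left mult_ac)

lemma norm_sq_add_outer_product:
  "(norm (X + outer_product w v))\<^sup>2
     = (norm X)\<^sup>2 + 2 * ((X *v v) \<bullet> w) + (norm v)\<^sup>2 * (norm w)\<^sup>2"
proof -
  have "outer_product w v \<bullet> outer_product w v = (norm v)\<^sup>2 * (norm w)\<^sup>2"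
    by (simp add: inner_outer_product outer_product_vector power2_norm_eq_inner)
  then show ?thesis
    using inner_outer_product[of X w v]
    by (simp add: power2_norm_eq_inner inner_add_left inner_add_right
        inner_commute[of "outer_product w v" X])
qed

section \<open>Orthonormal frames\<close>

lemma orthonormal_frames_iff_inner:
  fixes P :: "real ^ 'd ^ 'n"
  shows "P \<in> orthonormal_frames \<longleftrightarrow> (\<forall>x y. (P *v x) \<bullet> (P *v y) = x \<bullet> y)"
proof -
  have "P \<in> orthonormal_frames \<longleftrightarrow> (\<forall>y. transpose P *v (P *v y) = y)"
    by (simp add: orthonormal_frames_def matrix_eq matrix_vector_mul_assoc)
  also have "\<dots> \<longleftrightarrow> (\<forall>y x. x \<bullet> (transpose P *v (P *v y)) = x \<bullet> y)"
    by (metis vector_eq_rdot inner_commute)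
  finally show ?thesis by (auto simp: inner_matrix_vector_transpose)
qed

lemma norm_orthonormal_frame_mult:
  assumes "P \<in> orthonormal_frames"
  shows "norm (P *v x) = norm x"
  using assms by (simp add: orthonormal_frames_iff_inner norm_eq_sqrt_inner)

text \<open>Pythagoras for the rows of \<open>X\<close> under the orthogonal projection
  \<open>Q ** transpose Q\<close>; the projected rows have the coordinates \<open>X ** Q\<close> in
  the orthonormal columns of \<open>Q\<close>.\<close>

lemma norm_sq_orthonormal_frame_decomp:
  fixes X :: "real ^ 'n ^ 'm" and Q :: "real ^ 'd ^ 'n"
  assumes "Q \<in> orthonormal_frames"
  shows "(norm X)\<^sup>2 = (norm (X ** Q))\<^sup>2 + (norm (X - X ** Q ** transpose Q))\<^sup>2"
proof -
  have QQ: "transpose Q ** Q = mat 1"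
    using assms by (simp add: orthonormal_frames_def)
  have 1: "(X ** Q ** transpose Q) \<bullet> X = (norm (X ** Q))\<^sup>2"
    by (simp add: inner_matrix_mult_right transpose_transpose power2_norm_eq_inner)
  have "(X ** Q ** transpose Q) \<bullet> (X ** Q ** transpose Q)
      = (X ** Q) \<bullet> (X ** Q ** (transpose Q ** Q))"
    by (subst inner_matrix_mult_right) (simp add: transpose_transpose matrix_mul_assoc)
  then have 2: "(X ** Q ** transpose Q) \<bullet> (X ** Q ** transpose Q) = (norm (X ** Q))\<^sup>2"
    by (simp add: QQ power2_norm_eq_inner)
  show ?thesis
    using 1 2 by (simp add: power2_norm_eq_inner inner_diff_left inner_diff_right
        inner_commute[of X "X ** Q ** transpose Q"])
qed

text \<open>The rows of the product are the images of the rows of \<open>X\<close> under the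
  isometry \<open>P\<close>.\<close>

lemma norm_mult_transpose_orthonormal_frame:
  fixes X :: "real ^ 'd ^ 'm"
  assumes "P \<in> orthonormal_frames"
  shows "norm (X ** transpose P) = norm X"
proof -
  have "(X ** transpose P) \<bullet> (X ** transpose P) = X \<bullet> (X ** (transpose P ** P))"
    by (subst inner_matrix_mult_right) (simp add: transpose_transpose matrix_mul_assoc)
  then show ?thesis
    using assms by (simp add: orthonormal_frames_def norm_eq_sqrt_inner)
qed

text \<open>The rotation of the unit vector \<open>p = P v\<close> of the column space towards \<open>u\<close>, parametrised by the
  tangent of the angle to avoid trigonometric functions.\<close>

definition frame_rotation :: "real ^ 'd ^ 'n \<Rightarrow> real ^ 'd \<Rightarrow> real ^ 'n \<Rightarrow> real \<Rightarrow> real ^ 'd ^ 'n"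
  where "frame_rotation P v u s =
    P + outer_product ((P *v v + s *\<^sub>R u) /\<^sub>R sqrt (1 + s\<^sup>2 * (norm u)\<^sup>2) - P *v v) v"

lemma frame_rotation_0: "frame_rotation P v u 0 = P"
  by (simp add: frame_rotation_def outer_product_def vec_eq_iff)

lemma isCont_frame_rotation: "isCont (frame_rotation P v u) s"
proof -
  have "1 + t\<^sup>2 * (norm u)\<^sup>2 \<noteq> 0" for t
    by (metis add_pos_nonneg less_irrefl mult_nonneg_nonneg zero_le_power2 zero_less_one)
  then have "continuous_on UNIV (frame_rotation P v u)"
    unfolding frame_rotation_def outer_product_def
    by (intro continuous_intros) auto
  then show ?thesis by (simp add: continuous_on_eq_continuous_at)
qed

context
  fixes P :: "real ^ 'd ^ 'n" and v :: "real ^ 'd" and u :: "real ^ 'n"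
  assumes P: "P \<in> orthonormal_frames" and v: "norm v = 1" and u: "transpose P *v u = 0"
begin

text \<open>With \<open>w\<close> the displacement of \<open>P *v v\<close>, the inner product of
  the images of x and y changes by (v.x)(v.y)(2(1/r - 1) + w.w). This vanishes because the rotated
  vector has length 1, which forces w.w = 2 - 2/r.\<close>

lemma frame_rotation_orthonormal: "frame_rotation P v u s \<in> orthonormal_frames"
proof -
  define r where "r = sqrt (1 + s\<^sup>2 * (norm u)\<^sup>2)"
  define w where "w = (P *v v + s *\<^sub>R u) /\<^sub>R r - P *v v"
  have r: "r\<^sup>2 = 1 + s\<^sup>2 * (norm u)\<^sup>2" "r > 0"
    unfolding r_def by (auto intro: add_pos_nonneg)
  have PP: "(P *v x) \<bullet> (P *v y) = x \<bullet> y" for x y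
    using P by (simp add: orthonormal_frames_iff_inner)
  have Pu: "(P *v x) \<bullet> u = 0" for x
    by (simp add: inner_matrix_vector_transpose u)
  have vv: "v \<bullet> v = 1"
    using v by (simp add: norm_eq_1)
  have Pw: "(P *v x) \<bullet> w = (1 / r - 1) * (v \<bullet> x)" for x
    by (simp add: w_def inner_diff_right inner_add_right PP Pu inner_commute[of x] algebra_simps
        divide_inverse)
  have "(norm (P *v v + s *\<^sub>R u))\<^sup>2 = r\<^sup>2"
    using Pu[of v]
    by (simp add: r(1) power2_norm_eq_inner[of "_ + _"] inner_add_left inner_add_right PP vv
        inner_commute[of u "P *v v"] power2_norm_eq_inner[of u] power2_eq_square[of s])
  then have "norm (P *v v + s *\<^sub>R u) = r"
    using r(2) by (simp add: power2_eq_iff_nonneg)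
  then have rot: "norm ((P *v v + s *\<^sub>R u) /\<^sub>R r) = 1"
    using r(2) by simp
  have "(w + P *v v) \<bullet> (w + P *v v) = 1"
    using rot unfolding norm_eq_1 by (simp add: w_def)
  then have ww: "w \<bullet> w = 2 - 2 / r"
    using Pw[of v] by (simp add: inner_add_left inner_add_right PP vv
        inner_commute[of w "P *v v"] algebra_simps)
  have rot_eq: "frame_rotation P v u s *v x = P *v x + (v \<bullet> x) *\<^sub>R w" for x
    by (simp add: frame_rotation_def w_def r_def matrix_vector_mult_add_rdistrib
        outer_product_vector)
  show ?thesis
    by (simp add: orthonormal_frames_iff_inner rot_eq inner_add_left inner_add_right PP Pw ww
        inner_commute[of w "P *v _"] algebra_simps)
qed

text \<open>The squared Frobenius norm is the sum of the squared lengths of the images of any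
  orthonormal basis; in a basis containing \<open>v\<close>, only the term of \<open>v\<close>
  changes.\<close>

lemma norm_sq_mult_frame_rotation:
  "(norm (A ** frame_rotation P v u s))\<^sup>2 = (norm (A ** P))\<^sup>2
     + (norm (A *v (P *v v) + s *\<^sub>R (A *v u)))\<^sup>2 / (1 + s\<^sup>2 * (norm u)\<^sup>2) - (norm (A *v (P *v v)))\<^sup>2"
proof -
  define r where "r = sqrt (1 + s\<^sup>2 * (norm u)\<^sup>2)"
  have r: "r\<^sup>2 = 1 + s\<^sup>2 * (norm u)\<^sup>2"
    unfolding r_def by (auto intro: add_nonneg_nonneg)
  define a where "a = A *v (P *v v)"
  define b where "b = (a + s *\<^sub>R (A *v u)) /\<^sub>R r"
  have "A ** frame_rotation P v u s = A ** P + outer_product (b - a) v"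
    by (simp add: frame_rotation_def matrix_add_ldistrib matrix_mult_outer_product
        matrix_vector_mult_diff_distrib matrix_vector_mult_scaleR matrix_vector_right_distrib
        b_def a_def r_def)
  then have "(norm (A ** frame_rotation P v u s))\<^sup>2
      = (norm (A ** P))\<^sup>2 + 2 * (a \<bullet> (b - a)) + (norm (b - a))\<^sup>2"
    by (simp add: norm_sq_add_outer_product v a_def matrix_vector_mul_assoc)
  also have "\<dots> = (norm (A ** P))\<^sup>2 + (norm b)\<^sup>2 - (norm a)\<^sup>2"
    by (simp add: power2_norm_eq_inner inner_diff_left inner_diff_right inner_commute)
  also have "(norm b)\<^sup>2 = (norm (a + s *\<^sub>R (A *v u)))\<^sup>2 / r\<^sup>2"
    by (simp add: b_def power_mult_distrib power_inverse divide_inverse)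
  finally show ?thesis by (simp add: r a_def)
qed

end

section \<open>Local maximisers are global\<close>

lemma quadratic_nonpos_near_0:
  fixes b k :: real
  assumes "\<delta> > 0" and le: "\<And>s. \<bar>s\<bar> < \<delta> \<Longrightarrow> 2 * s * b + s\<^sup>2 * k \<le> 0"
  shows "b = 0" "k \<le> 0"
proof -
  \<comment> \<open>Adding the inequalities at \<open>\<delta>/2\<close> and
    \<open>-\<delta>/2\<close> cancels the linear term.\<close>
  have "(\<delta>/2)\<^sup>2 * k \<le> 0"
    using le[of "\<delta>/2"] le[of "-\<delta>/2"] \<open>\<delta> > 0\<close> by simp
  then show "k \<le> 0"
    using \<open>\<delta> > 0\<close> by (simp add: mult_le_0_iff)
  show "b = 0"
  proof (rule ccontr)
    assume "b \<noteq> 0"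
    \<comment> \<open>The test point is \<open>s = e * b\<close>: the first bound keeps it within
      \<open>\<delta>\<close>, the second gives \<open>\<bar>e * k\<bar> \<le> 1\<close>, so the
      linear term dominates and is positive.\<close>
    define e where "e = min (\<delta> / (2 * \<bar>b\<bar>)) (1 / (1 + \<bar>k\<bar>))"
    have e: "e > 0" "e \<le> \<delta> / (2 * \<bar>b\<bar>)" "e \<le> 1 / (1 + \<bar>k\<bar>)"
      using \<open>b \<noteq> 0\<close> \<open>\<delta> > 0\<close> by (auto simp: e_def)
    have "\<bar>e * b\<bar> \<le> \<delta> / 2"
      using e(1,2) \<open>b \<noteq> 0\<close> by (simp add: abs_mult field_simps)
    then have "2 * (e * b) * b + (e * b)\<^sup>2 * k \<le> 0"
      using \<open>\<delta> > 0\<close> by (intro le) auto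
    moreover have "2 * (e * b) * b + (e * b)\<^sup>2 * k = (e * b\<^sup>2) * (2 + e * k)"
      by (simp add: power2_eq_square algebra_simps)
    moreover have "e * b\<^sup>2 > 0"
      using e(1) \<open>b \<noteq> 0\<close> by simp
    ultimately have "2 + e * k \<le> 0"
      by (metis mult_pos_pos not_le)
    moreover have "e * (1 + \<bar>k\<bar>) \<le> 1"
      using e(3) by (simp add: field_simps)
    then have "e * \<bar>k\<bar> \<le> 1"
      using e(1) by (simp add: algebra_simps)
    then have "\<bar>e * k\<bar> \<le> 1"
      using e(1) by (simp add: abs_mult)
    ultimately show False by linarith
  qed
qed

text \<open>Along the rotation, clearing the denominator of the objective leaves a quadratic in
  \<open>s\<close> without constant term that is nonpositive near 0. Its linear coefficient gives
  the first claim, its quadratic one the second.\<close>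

lemma local_max_frame_conditions:
  fixes A :: "real ^ 'n ^ 'm" and P :: "real ^ 'd ^ 'n"
  assumes P: "P \<in> orthonormal_frames"
    and "\<delta> > 0"
    and max: "\<And>R. R \<in> orthonormal_frames \<Longrightarrow> dist R P < \<delta> \<Longrightarrow> (norm (A ** R))\<^sup>2 \<le> (norm (A ** P))\<^sup>2"
    and v: "norm v = 1" and u: "transpose P *v u = 0"
  shows "(A *v (P *v v)) \<bullet> (A *v u) = 0"
    and "(norm (A *v u))\<^sup>2 \<le> (norm (A *v (P *v v)))\<^sup>2 * (norm u)\<^sup>2"
proof -
  define a where "a = A *v (P *v v)"
  define b where "b = A *v u"
  obtain \<epsilon> where "\<epsilon> > 0" and \<epsilon>: "\<And>s. \<bar>s\<bar> < \<epsilon> \<Longrightarrow> dist (frame_rotation P v u s) P < \<delta>"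
    using isCont_frame_rotation[of 0 P v u] \<open>\<delta> > 0\<close>
    unfolding continuous_at_eps_delta frame_rotation_0 by (auto simp: dist_norm)
  have "2 * s * (a \<bullet> b) + s\<^sup>2 * ((norm b)\<^sup>2 - (norm a)\<^sup>2 * (norm u)\<^sup>2) \<le> 0" if "\<bar>s\<bar> < \<epsilon>" for s
  proof -
    have pos: "1 + s\<^sup>2 * (norm u)\<^sup>2 > 0"
      by (auto intro: add_pos_nonneg)
    have "(norm (a + s *\<^sub>R b))\<^sup>2 / (1 + s\<^sup>2 * (norm u)\<^sup>2) \<le> (norm a)\<^sup>2"
      using max[OF frame_rotation_orthonormal[OF P v u] \<epsilon>[OF that]]
      by (simp add: norm_sq_mult_frame_rotation[OF P v u] a_def b_def)
    then have "(norm (a + s *\<^sub>R b))\<^sup>2 \<le> (norm a)\<^sup>2 * (1 + s\<^sup>2 * (norm u)\<^sup>2)"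
      using pos by (simp add: pos_divide_le_eq)
    moreover have "(norm (a + s *\<^sub>R b))\<^sup>2 = (norm a)\<^sup>2 + 2 * s * (a \<bullet> b) + s\<^sup>2 * (norm b)\<^sup>2"
      unfolding power2_norm_eq_inner
      by (simp add: inner_add_left inner_add_right inner_commute[of b a] power2_eq_square
          algebra_simps)
    ultimately show ?thesis by (simp add: algebra_simps)
  qed
  from quadratic_nonpos_near_0[OF \<open>\<epsilon> > 0\<close> this]
  show "(A *v (P *v v)) \<bullet> (A *v u) = 0"
    and "(norm (A *v u))\<^sup>2 \<le> (norm (A *v (P *v v)))\<^sup>2 * (norm u)\<^sup>2"
    by (simp_all add: a_def b_def)
qed

text \<open>\<open>A ** Q\<close> and \<open>A ** P\<close> share the contribution of
  \<open>T ** Q\<close>. What remains is that of \<open>Y\<close> and of \<open>T ** Z\<close>, two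
  matrices of equal norm, and a constant \<open>c\<close> separates the form on their
  columns.\<close>

lemma local_max_frame_global:
  fixes A :: "real ^ 'n ^ 'm" and P Q :: "real ^ 'd ^ 'n"
  assumes P: "P \<in> orthonormal_frames" and Q: "Q \<in> orthonormal_frames"
    and "\<delta> > 0"
    and max: "\<And>R. R \<in> orthonormal_frames \<Longrightarrow> dist R P < \<delta> \<Longrightarrow> (norm (A ** R))\<^sup>2 \<le> (norm (A ** P))\<^sup>2"
  shows "(norm (A ** Q))\<^sup>2 \<le> (norm (A ** P))\<^sup>2"
proof -
  note conditions = local_max_frame_conditions[OF P \<open>\<delta> > 0\<close> max]
  \<comment> \<open>\<open>T\<close> projects orthogonally onto the column space of
    \<open>P\<close>; \<open>Y\<close> is the part of \<open>Q\<close> in the complement.\<close>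
  define T where "T = P ** transpose P"
  define Y where "Y = Q - T ** Q"
  have PP: "transpose P ** P = mat 1"
    using P by (simp add: orthonormal_frames_def)
  have "continuous_on (sphere 0 1) (\<lambda>v. (norm (A *v (P *v v)))\<^sup>2)"
    unfolding matrix_vector_mult_def by (intro continuous_intros)
  moreover have "sphere (0 :: real ^ 'd) 1 \<noteq> {}"
    by simp
  ultimately obtain v0 :: "real ^ 'd" where v0: "norm v0 = 1"
    and v0_min: "\<And>v. norm v = 1 \<Longrightarrow> (norm (A *v (P *v v0)))\<^sup>2 \<le> (norm (A *v (P *v v)))\<^sup>2"
    using continuous_attains_inf[OF compact_sphere, of 0 1 "\<lambda>v. (norm (A *v (P *v v)))\<^sup>2"] by auto
  \<comment> \<open>The least value of the form on unit vectors of the column space. Taking the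
    conditions at the minimiser \<open>v0\<close> makes the same \<open>c\<close> an upper bound on
    the complement.\<close>
  define c where "c = (norm (A *v (P *v v0)))\<^sup>2"
  have lower: "c * (norm (P *v v))\<^sup>2 \<le> (norm (A *v (P *v v)))\<^sup>2" for v
  proof (cases "v = 0")
    case False
    have "c \<le> (norm (A *v (P *v (v /\<^sub>R norm v))))\<^sup>2"
      unfolding c_def using False by (intro v0_min) simp
    also have "\<dots> = (norm (A *v (P *v v)))\<^sup>2 / (norm v)\<^sup>2"
      by (simp add: matrix_vector_mult_scaleR power_mult_distrib divide_inverse power_inverse)
    finally show ?thesis
      using False by (simp add: norm_orthonormal_frame_mult[OF P] pos_le_divide_eq)
  qed simp
  have upper: "(norm (A *v u))\<^sup>2 \<le> c * (norm u)\<^sup>2" if "transpose P *v u = 0" for u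
    using conditions(2)[OF _ _ v0 that] by (simp add: c_def)
  have orth: "(A *v (P *v v)) \<bullet> (A *v u) = 0" if "transpose P *v u = 0" for u v
  proof (cases "v = 0")
    case False
    then show ?thesis
      using conditions(1)[OF _ _ _ that, of "v /\<^sub>R norm v"]
      by (simp add: matrix_vector_mult_scaleR)
  qed simp
  have "transpose P ** Y = 0"
    by (simp add: Y_def T_def matrix_mult_diff_distrib matrix_mul_assoc PP)
  then have colY: "transpose P *v column j Y = 0" for j
    by (simp add: column_matrix_mult[symmetric]) (simp add: column_def vec_eq_iff)
  have colT: "column j (T ** X) = P *v column j (transpose P ** X)" for j and X :: "real ^ 'k ^ 'n"
    by (simp add: T_def column_matrix_mult matrix_vector_mul_assoc matrix_mul_assoc)

  have "Q = T ** Q + Y"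
    by (simp add: Y_def)
  then have split: "A ** Q = A ** (T ** Q) + A ** Y"
    by (metis matrix_add_ldistrib)
  have "(A ** (T ** Q)) \<bullet> (A ** Y) = 0"
    unfolding inner_matrix_eq_sum_columns column_matrix_mult[of _ A] colT
    by (simp add: orth colY)
  then have 1: "(norm (A ** Q))\<^sup>2 = (norm (A ** (T ** Q)))\<^sup>2 + (norm (A ** Y))\<^sup>2"
    unfolding split by (simp add: power2_norm_eq_inner inner_add_left inner_add_right inner_commute)
  have 2: "(norm (A ** Y))\<^sup>2 \<le> c * (norm Y)\<^sup>2"
    unfolding norm_sq_matrix_eq_sum_columns column_matrix_mult[of _ A] sum_distrib_left
    by (intro sum_mono upper colY)

  \<comment> \<open>The projection onto the complement of the column space of
    \<open>Q\<close>.\<close>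
  define Z where "Z = mat 1 - Q ** transpose Q"
  have Z: "X ** Z = X - X ** Q ** transpose Q" for X :: "real ^ 'n ^ 'k"
    by (simp add: Z_def matrix_mult_diff_distrib matrix_mul_assoc)
  have 3: "c * (norm (T ** Z))\<^sup>2 \<le> (norm (A ** (T ** Z)))\<^sup>2"
    unfolding norm_sq_matrix_eq_sum_columns column_matrix_mult[of _ A] sum_distrib_left colT
    by (intro sum_mono lower)
  have 4: "(norm (A ** P))\<^sup>2 = (norm (A ** (T ** Q)))\<^sup>2 + (norm (A ** (T ** Z)))\<^sup>2"
    using norm_sq_orthonormal_frame_decomp[OF Q, of "A ** T"]
      norm_mult_transpose_orthonormal_frame[OF P, of "A ** P"]
    by (simp add: T_def matrix_mul_assoc Z matrix_mult_diff_distrib)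
  have 5: "(norm P)\<^sup>2 = (norm (T ** Q))\<^sup>2 + (norm (T ** Z))\<^sup>2"
    using norm_sq_orthonormal_frame_decomp[OF Q, of T]
      norm_mult_transpose_orthonormal_frame[OF P, of P]
    by (simp add: T_def Z)
  have "(T ** Q) \<bullet> Y = 0"
    using \<open>transpose P ** Y = 0\<close>
    by (simp add: T_def inner_matrix_mult_left flip: matrix_mul_assoc)
  then have 6: "(norm Q)\<^sup>2 = (norm (T ** Q))\<^sup>2 + (norm Y)\<^sup>2"
    using \<open>Q = T ** Q + Y\<close>
    by (metis norm_add_Pythagorean orthogonal_def)
  \<comment> \<open>Both frames have squared norm \<open>CARD('d)\<close>, so what \<open>Q\<close>
    has outside the column space of \<open>P\<close> equals in size what it misses inside.\<close>
  have "(norm Y)\<^sup>2 = (norm (T ** Z))\<^sup>2"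
    using 5 6 norm_sq_orthonormal_frame[OF P] norm_sq_orthonormal_frame[OF Q] by simp
  with 2 have "(norm (A ** Y))\<^sup>2 \<le> c * (norm (T ** Z))\<^sup>2"
    by simp
  then show ?thesis using 1 3 4 by linarith
qed

section \<open>Comparing the two losses at a minimax solution\<close>

lemma minimax_pca_loss_le:
  fixes A1 :: "real ^ 'n ^ 'm1" and A2 :: "real ^ 'n ^ 'm2" and P :: "real ^ 'd ^ 'n"
  assumes "is_arg_min (\<lambda>P. max (pca_loss A1 P) (pca_loss A2 P)) (\<lambda>P. P \<in> orthonormal_frames) P"
  shows "pca_loss A1 P \<le> pca_loss A2 P"
proof (rule ccontr)
  assume less: "\<not> pca_loss A1 P \<le> pca_loss A2 P"
  have P: "P \<in> orthonormal_frames"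
    using assms unfolding is_arg_min_linorder by (rule conjunct1)
  have min: "max (pca_loss A1 P) (pca_loss A2 P) \<le> max (pca_loss A1 R) (pca_loss A2 R)"
    if "R \<in> orthonormal_frames" for R :: "real ^ 'd ^ 'n"
    using assms[unfolded is_arg_min_linorder, THEN conjunct2, rule_format, OF that] .
  from P have ne: "(orthonormal_frames :: (real ^ 'd ^ 'n) set) \<noteq> {}" by blast
  have "continuous_on UNIV (pca_loss A2 :: real ^ 'd ^ 'n \<Rightarrow> real)"
    unfolding pca_loss_def[abs_def] matrix_matrix_mult_def by (intro continuous_intros)
  then have "isCont (pca_loss A2) P"
    by (simp add: continuous_on_eq_continuous_at)
  \<comment> \<open>The gap between the losses serves as the tolerance: near \<open>P\<close> the
    second loss stays below \<open>pca_loss A1 P\<close>, so by optimality the first loss cannot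
    drop there.\<close>
  then obtain \<delta> where "\<delta> > 0"
    and \<delta>: "\<And>R. dist R P < \<delta> \<Longrightarrow> dist (pca_loss A2 R) (pca_loss A2 P) < pca_loss A1 P - pca_loss A2 P"
    using less unfolding continuous_at_eps_delta dist_norm by (metis diff_gt_0_iff_gt not_le)
  have local_max: "(norm (A1 ** R))\<^sup>2 \<le> (norm (A1 ** P))\<^sup>2"
    if "R \<in> orthonormal_frames" "dist R P < \<delta>" for R :: "real ^ 'd ^ 'n"
  proof -
    have "pca_loss A2 R < pca_loss A1 P"
      using \<delta>[OF that(2)] by (simp add: dist_real_def)
    then have "pca_loss A1 P \<le> pca_loss A1 R"
      using min[OF that(1)] by linarith
    then show ?thesis by (simp add: pca_loss_def)
  qed
  \<comment> \<open>\<open>Q\<close> attains the maximum for \<open>A1\<close>; as the local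
    maximiser \<open>P\<close> is global, \<open>P\<close> attains it too.\<close>
  obtain Q :: "real ^ 'd ^ 'n" where Q: "Q \<in> orthonormal_frames"
    and "\<And>R :: real ^ 'd ^ 'n. pca_loss A1 R = (norm (A1 ** Q))\<^sup>2 - (norm (A1 ** R))\<^sup>2"
    using pca_loss_attained[OF ne, of A1] by metis
  then have "pca_loss A1 P \<le> 0"
    using local_max_frame_global[OF P Q \<open>\<delta> > 0\<close> local_max] by simp
  moreover have "0 \<le> pca_loss A2 P"
    using pca_loss_attained[OF ne, of A2] P by (metis diff_ge_0_iff_ge)
  ultimately show False using less by simp
qed

theorem theorem8:
  fixes A1 :: "real ^ 'n ^ 'm1" and A2 :: "real ^ 'n ^ 'm2" and Pstar :: "real ^ 'd ^ 'n"
  assumes "CARD('d) \<le> CARD('n)"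
    and "is_arg_min (\<lambda>P. max (pca_loss A1 P) (pca_loss A2 P)) (\<lambda>P. P \<in> orthonormal_frames) Pstar"
  shows "pca_loss A1 Pstar = pca_loss A2 Pstar"
proof (rule antisym)
  show "pca_loss A1 Pstar \<le> pca_loss A2 Pstar"
    using assms(2) by (rule minimax_pca_loss_le)
  have "is_arg_min (\<lambda>P. max (pca_loss A2 P) (pca_loss A1 P)) (\<lambda>P. P \<in> orthonormal_frames) Pstar"
    using assms(2) by (simp add: max.commute)
  then show "pca_loss A2 Pstar \<le> pca_loss A1 Pstar"
    by (rule minimax_pca_loss_le)
qed

end
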